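(* A represented space $(X,\rho)$ has a computable open choice problem if and only if it is computably separable. In particular, a represented space with computable open choice is overt.
   Context: A represented space $(X,\rho)$ is a set with a partial surjection $\rho:\subseteq\mathbb{N}^{\mathbb{N}}\to X$, computability via realizers on names, final topology on $X$. $\mathcal{O}(X)$ is the set of open sets, represented by names of their characteristic maps into Sierpiński space ($c_{\mathbb{S}}(0^\omega)=0$, otherwise $1$). Open choice is the multifunction $OC:\mathcal{O}(X)\setminus\{\emptyset\}\rightrightarrows X$, $O\mapsto O$ (output any point of $O$). $(X,\rho)$ is computably separable if there is a computable sequence of points of $X$ with dense image. $(X,\rho)$ is overt if the map $\mathcal{O}(X)\to\mathbb{S}$, $O\mapsto[O\neq\emptyset]$, is computable.
   Formalization: The equivalence is stated for nonempty X, since for X = ∅ open choice is trivially computable while no sequence of points of X exists; the overtness claim is stated for all X. *)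

theory Defs
  imports "HOL-Analysis.Function_Topology" "HOL-Library.Nat_Bijection"
begin

type_synonym baire = "nat \<Rightarrow> nat"

text \<open>
  Computability on Baire space is the usual notion of oracle computation: programs are
  partial recursive schemes with one additional basic function, the oracle, which answers
  queries to the input sequence.
\<close>

datatype prog =
    Zero
  | Succ
  | Proj nat
  | Oracle
  | Comp prog "prog list"
  | PrimRec prog prog
  | Mu prog

inductive evals :: "baire \<Rightarrow> prog \<Rightarrow> nat list \<Rightarrow> nat \<Rightarrow> bool" for p :: baire where
  evals_Zero: "evals p Zero xs 0"
| evals_Succ: "evals p Succ [x] (Suc x)"
| evals_Proj: "i < length xs \<Longrightarrow> evals p (Proj i) xs (xs ! i)"
| evals_Oracle: "evals p Oracle [x] (p x)"
| evals_Comp: "list_all2 (\<lambda>g y. evals p g xs y) gs ys \<Longrightarrow> evals p f ys z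
    \<Longrightarrow> evals p (Comp f gs) xs z"
| evals_PrimRec_0: "evals p f xs z \<Longrightarrow> evals p (PrimRec f g) (0 # xs) z"
| evals_PrimRec_Suc: "evals p (PrimRec f g) (n # xs) y \<Longrightarrow> evals p g (n # y # xs) z
    \<Longrightarrow> evals p (PrimRec f g) (Suc n # xs) z"
| evals_Mu: "evals p f (n # xs) 0 \<Longrightarrow> \<forall>m<n. \<exists>y. evals p f (m # xs) (Suc y)
    \<Longrightarrow> evals p (Mu f) xs n"

text \<open>The program may also converge outside the domain of \<open>F\<close>.\<close>

definition baire_computable :: "(baire \<rightharpoonup> baire) \<Rightarrow> bool" where
  "baire_computable F \<longleftrightarrow> (\<exists>e. \<forall>p q. F p = Some q \<longrightarrow> (\<forall>n. evals p e [n] (q n)))"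

definition represented_space :: "'x set \<Rightarrow> (baire \<rightharpoonup> 'x) \<Rightarrow> bool" where
  "represented_space X \<rho> \<longleftrightarrow> ran \<rho> = X"

text \<open>
  A multifunction is a set-valued function \<open>f\<close> whose domain is the set of points \<open>x\<close> with
  \<open>f x \<noteq> {}\<close>.
\<close>

definition realizes ::
  "(baire \<rightharpoonup> 'x) \<Rightarrow> (baire \<rightharpoonup> 'y) \<Rightarrow> (baire \<rightharpoonup> baire) \<Rightarrow> ('x \<Rightarrow> 'y set) \<Rightarrow> bool" where
  "realizes \<rho> \<sigma> F f \<longleftrightarrow>
    (\<forall>p x. \<rho> p = Some x \<and> f x \<noteq> {} \<longrightarrow> (\<exists>q y. F p = Some q \<and> \<sigma> q = Some y \<and> y \<in> f x))"

definition computable_multi :: "(baire \<rightharpoonup> 'x) \<Rightarrow> (baire \<rightharpoonup> 'y) \<Rightarrow> ('x \<Rightarrow> 'y set) \<Rightarrow> bool" where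
  "computable_multi \<rho> \<sigma> f \<longleftrightarrow> (\<exists>F. baire_computable F \<and> realizes \<rho> \<sigma> F f)"

definition computable_map :: "(baire \<rightharpoonup> 'x) \<Rightarrow> (baire \<rightharpoonup> 'y) \<Rightarrow> ('x \<Rightarrow> 'y) \<Rightarrow> bool" where
  "computable_map \<rho> \<sigma> f \<longleftrightarrow> computable_multi \<rho> \<sigma> (\<lambda>x. {f x})"

definition nat_rep :: "baire \<rightharpoonup> nat" where
  "nat_rep p = Some (p 0)"

text \<open>Sierpinski space, with \<open>False\<close> for \<open>0\<close> and \<open>True\<close> for \<open>1\<close>.\<close>

definition sierpinski_rep :: "baire \<rightharpoonup> bool" where
  "sierpinski_rep p = Some (p \<noteq> (\<lambda>_. 0))"

definition final_topology :: "(baire \<rightharpoonup> 'x) \<Rightarrow> 'x topology" where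
  "final_topology \<rho> = topology (\<lambda>U. U \<subseteq> ran \<rho> \<and>
      openin (top_of_set (dom \<rho>)) {p \<in> dom \<rho>. the (\<rho> p) \<in> U})"

lemma openin_final_topology:
  "openin (final_topology \<rho>) U \<longleftrightarrow> U \<subseteq> ran \<rho> \<and>
      openin (top_of_set (dom \<rho>)) {p \<in> dom \<rho>. the (\<rho> p) \<in> U}"
proof -
  let ?T = "top_of_set (dom \<rho>)"
  let ?P = "\<lambda>U. {p \<in> dom \<rho>. the (\<rho> p) \<in> U}"
  have "istopology (\<lambda>U. U \<subseteq> ran \<rho> \<and> openin ?T (?P U))"
    unfolding istopology_def
  proof (intro conjI allI impI)
    fix S T assume "S \<subseteq> ran \<rho> \<and> openin ?T (?P S)" "T \<subseteq> ran \<rho> \<and> openin ?T (?P T)"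
    moreover have "?P (S \<inter> T) = ?P S \<inter> ?P T" by auto
    ultimately show "S \<inter> T \<subseteq> ran \<rho>" "openin ?T (?P (S \<inter> T))"
      by (auto simp: openin_Int)
  next
    fix K assume K: "\<forall>S\<in>K. S \<subseteq> ran \<rho> \<and> openin ?T (?P S)"
    then show "\<Union>K \<subseteq> ran \<rho>" by auto
    have "?P (\<Union>K) = \<Union>(?P ` K)" by auto
    then show "openin ?T (?P (\<Union>K))" using K by (auto intro: openin_Union)
  qed
  then show ?thesis by (simp add: final_topology_def topology_inverse')
qed

lemma topspace_final_topology: "topspace (final_topology \<rho>) = ran \<rho>"
proof -
  have "{p \<in> dom \<rho>. the (\<rho> p) \<in> ran \<rho>} = dom \<rho>" by (auto simp: ran_def)
  then have "openin (final_topology \<rho>) (ran \<rho>)"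
    by (simp add: openin_final_topology)
  then show ?thesis
    by (metis openin_final_topology openin_subset openin_topspace subset_antisym)
qed

text \<open>
  The continuous partial function on Baire space coded by \<open>p\<close>, in the sense of Kleene
  associates: to determine the value at \<open>n\<close>, \<open>p\<close> is queried on longer and longer prefixes of
  the argument \<open>q\<close>, where the answer \<open>0\<close> means \<open>undecided\<close> and \<open>m + 1\<close> means \<open>m\<close>.
\<close>

definition assoc_app :: "baire \<Rightarrow> (baire \<rightharpoonup> baire)" where
  "assoc_app p q =
    (let ask = (\<lambda>n k. p (list_encode (n # map q [0..<k])))
     in if \<forall>n. \<exists>k. ask n k > 0 then Some (\<lambda>n. ask n (LEAST k. ask n k > 0) - 1) else None)"

definition names_map :: "(baire \<rightharpoonup> 'x) \<Rightarrow> (baire \<rightharpoonup> 'y) \<Rightarrow> baire \<Rightarrow> ('x \<Rightarrow> 'y) \<Rightarrow> bool" where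
  "names_map \<rho> \<sigma> p f \<longleftrightarrow> realizes \<rho> \<sigma> (assoc_app p) (\<lambda>x. {f x})"

definition open_name :: "(baire \<rightharpoonup> 'x) \<Rightarrow> baire \<Rightarrow> 'x set \<Rightarrow> bool" where
  "open_name \<rho> p U \<longleftrightarrow>
    openin (final_topology \<rho>) U \<and> names_map \<rho> sierpinski_rep p (\<lambda>x. x \<in> U)"

definition open_rep :: "(baire \<rightharpoonup> 'x) \<Rightarrow> (baire \<rightharpoonup> 'x set)" where
  "open_rep \<rho> p = (if \<exists>U. open_name \<rho> p U then Some (THE U. open_name \<rho> p U) else None)"

lemma open_name_unique:
  assumes "open_name \<rho> p U" "open_name \<rho> p V"
  shows "U = V"
proof -
  have "x \<in> U \<longleftrightarrow> x \<in> V" if "x \<in> ran \<rho>" for x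
  proof -
    from that obtain r where "\<rho> r = Some x" by (auto simp: ran_def)
    with assms show ?thesis
      unfolding open_name_def names_map_def realizes_def by fastforce
  qed
  moreover have "U \<subseteq> ran \<rho>" "V \<subseteq> ran \<rho>"
    using assms by (auto simp: open_name_def openin_final_topology)
  ultimately show ?thesis by blast
qed

lemma open_rep_eq_Some_iff: "open_rep \<rho> p = Some U \<longleftrightarrow> open_name \<rho> p U"
proof
  assume "open_rep \<rho> p = Some U"
  then obtain V where "open_name \<rho> p V" "U = (THE U. open_name \<rho> p U)"
    by (auto simp: open_rep_def split: if_splits)
  then show "open_name \<rho> p U" by (metis open_name_unique the_equality)
next
  assume "open_name \<rho> p U"
  then show "open_rep \<rho> p = Some U"
    by (auto simp: open_rep_def intro!: the_equality dest: open_name_unique)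
qed

text \<open>As a multifunction, its domain consists of the nonempty open sets.\<close>

definition open_choice :: "'x set \<Rightarrow> 'x set" where
  "open_choice U = U"

definition computable_open_choice :: "(baire \<rightharpoonup> 'x) \<Rightarrow> bool" where
  "computable_open_choice \<rho> \<longleftrightarrow> computable_multi (open_rep \<rho>) \<rho> open_choice"

definition computably_separable :: "(baire \<rightharpoonup> 'x) \<Rightarrow> bool" where
  "computably_separable \<rho> \<longleftrightarrow>
    (\<exists>s :: nat \<Rightarrow> 'x. computable_map nat_rep \<rho> s \<and>
       final_topology \<rho> closure_of range s = topspace (final_topology \<rho>))"

definition overt :: "(baire \<rightharpoonup> 'x) \<Rightarrow> bool" where
  "overt \<rho> \<longleftrightarrow> computable_map (open_rep \<rho>) sierpinski_rep (\<lambda>U. U \<noteq> {})"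

end

theory Submission
  imports Defs
begin

text \<open>
  Every finite word extends to a computable name of the whole space: a finite part of an
  associate fixes only finitely many digits of the answer, so all later digits may still be
  answered positively. Feeding these names to a realizer of open choice gives a computable
  sequence of points. It is dense because the realizer is continuous: on a name of a nonempty
  open set \<open>U\<close> it returns a name of a point of \<open>U\<close>, and on the extensions of longer and longer
  prefixes of that name its outputs converge to it, hence are eventually names of points of \<open>U\<close>.

  Conversely, given a dense computable sequence \<open>s\<close> and a name of \<open>U\<close>, one searches for a pair
  \<open>(n, m)\<close> such that digit \<open>m\<close> of the answer to \<open>s n \<in> U\<close> is positive. Such a pair exists iff
  \<open>U\<close> is nonempty, which also gives overtness.
\<close>

section \<open>Determinism, continuity and oracle substitution\<close>

lemma evals_deterministic:
  assumes "evals p e xs y" "evals p e xs z"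
  shows "y = z"
  using assms
proof (induction arbitrary: z rule: evals.induct)
  case (evals_Zero xs)
  then show ?case by (auto elim: evals.cases)
next
  case (evals_Succ x)
  then show ?case by (auto elim: evals.cases)
next
  case (evals_Proj i xs)
  from evals_Proj.prems show ?case by cases auto
next
  case (evals_Oracle x)
  then show ?case by (auto elim: evals.cases)
next
  case (evals_Comp xs gs ys f y)
  from evals_Comp.prems obtain ys' where
    ys': "list_all2 (\<lambda>g y. evals p g xs y) gs ys'" "evals p f ys' z"
    by cases auto
  have "ys = ys'"
    using evals_Comp.IH(1) ys'(1) by (auto simp: list_all2_conv_all_nth intro!: nth_equalityI)
  with ys' evals_Comp.IH(2) show ?case by simp
next
  case (evals_PrimRec_0 f xs y g)
  from evals_PrimRec_0.prems show ?case by cases (auto intro: evals_PrimRec_0.IH)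
next
  case (evals_PrimRec_Suc f g n xs y y')
  from evals_PrimRec_Suc.prems obtain u where
    "evals p (PrimRec f g) (n # xs) u" "evals p g (n # u # xs) z"
    by cases auto
  with evals_PrimRec_Suc.IH show ?case by blast
next
  case (evals_Mu f n xs)
  from evals_Mu.prems have z: "evals p f (z # xs) 0" "\<forall>m<z. \<exists>y. evals p f (m # xs) (Suc y)"
    by (cases, simp)+
  \<comment> \<open>At the smaller of \<open>n\<close> and \<open>z\<close>, the program
    \<open>f\<close> would return both 0 and a successor.\<close>
  show ?case
  proof (rule linorder_cases[of n z])
    assume "n < z"
    with z(2) obtain y where "evals p f (n # xs) (Suc y)" by blast
    with evals_Mu.IH(1) show ?thesis by blast
  next
    assume "z < n"
    with evals_Mu.IH(2) z(1) show ?thesis by blast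
  qed
qed

text \<open>A converging run asks the oracle only finitely often. Phrasing this with
  \<open>eventually\<close> lets the bounds of finitely many subcomputations combine without an
  explicit maximum.\<close>

lemma evals_continuous:
  assumes "evals p e xs y"
  shows "\<forall>\<^sub>F k in sequentially. \<forall>p'. (\<forall>i<k. p' i = p i) \<longrightarrow> evals p' e xs y"
  using assms
proof (induction rule: evals.induct)
  case (evals_Oracle x)
  show ?case
    using eventually_gt_at_top[of x]
    by eventually_elim (metis evals.evals_Oracle)
next
  case (evals_Comp xs gs ys f y)
  have "\<forall>\<^sub>F k in sequentially. \<forall>j\<in>{..<length gs}.
      \<forall>p'. (\<forall>i<k. p' i = p i) \<longrightarrow> evals p' (gs ! j) xs (ys ! j)"
    by (rule eventually_ball_finite) (use evals_Comp.IH(1) in \<open>auto simp: list_all2_conv_all_nth\<close>)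
  with evals_Comp.IH(2) show ?case
  proof eventually_elim
    case (elim k)
    show ?case
    proof (intro allI impI)
      fix p' assume "\<forall>i<k. p' i = p i"
      with elim evals_Comp.IH(1) show "evals p' (Comp f gs) xs y"
        by (auto intro!: evals.evals_Comp[of _ _ _ ys] simp: list_all2_conv_all_nth)
    qed
  qed
next
  case (evals_PrimRec_Suc f g n xs y z)
  from evals_PrimRec_Suc.IH show ?case
    by eventually_elim (blast intro: evals.evals_PrimRec_Suc)
next
  case (evals_PrimRec_0 f xs z g)
  from evals_PrimRec_0.IH show ?case
    by eventually_elim (blast intro: evals.evals_PrimRec_0)
next
  case (evals_Mu f n xs)
  have "\<forall>\<^sub>F k in sequentially. \<forall>m\<in>{..<n}.
      \<forall>p'. (\<forall>i<k. p' i = p i) \<longrightarrow> (\<exists>y. evals p' f (m # xs) (Suc y))"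
  proof (rule eventually_ball_finite; clarsimp)
    fix m assume "m < n"
    with evals_Mu.IH(2) obtain y where "\<forall>\<^sub>F k in sequentially.
        \<forall>p'. (\<forall>i<k. p' i = p i) \<longrightarrow> evals p' f (m # xs) (Suc y)"
      by blast
    then show "\<forall>\<^sub>F k in sequentially.
        \<forall>p'. (\<forall>i<k. p' i = p i) \<longrightarrow> (\<exists>y. evals p' f (m # xs) (Suc y))"
      by eventually_elim blast
  qed
  with evals_Mu.IH(1) show ?case
    by eventually_elim (blast intro: evals.evals_Mu)
qed (auto intro!: always_eventually evals.intros)

text \<open>
  The number \<open>k\<close> is the arity at which the program is run; the \<open>l\<close> parameters of the new
  oracle program \<open>h\<close> are carried along behind the \<open>k\<close> proper arguments.
\<close>

fun subst_oracle :: "prog \<Rightarrow> nat \<Rightarrow> nat \<Rightarrow> prog \<Rightarrow> prog" where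
  "subst_oracle h l k Zero = Zero"
| "subst_oracle h l k Succ = Comp Succ [Proj 0]"
| "subst_oracle h l k (Proj i) = Proj i"
| "subst_oracle h l k Oracle = h"
| "subst_oracle h l k (Comp f gs) =
    Comp (subst_oracle h l (length gs) f) (map (subst_oracle h l k) gs @ map Proj [k..<k + l])"
| "subst_oracle h l k (PrimRec f g) =
    PrimRec (subst_oracle h l (k - 1) f) (subst_oracle h l (Suc k) g)"
| "subst_oracle h l k (Mu f) = Mu (subst_oracle h l (Suc k) f)"

lemma evals_projs:
  assumes "b \<le> length xs"
  shows "list_all2 (\<lambda>g y. evals p g xs y) (map Proj [a..<b]) (map ((!) xs) [a..<b])"
  using assms by (auto simp: list_all2_conv_all_nth intro: evals_Proj)

text \<open>An oracle call has the argument list \<open>[x]\<close>; with \<open>ps\<close> behind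
  it, \<open>h\<close> sees \<open>x # ps\<close> and answers \<open>q x\<close>. Since the
  parameters come last, proper arguments keep their positions. \<open>Succ\<close> accepts exactly
  one argument and must therefore select it first.\<close>

lemma evals_subst_oracle:
  assumes "evals q e xs y" and "length ps = l" and h: "\<And>x. evals p h (x # ps) (q x)"
  shows "evals p (subst_oracle h l (length xs) e) (xs @ ps) y"
  using assms(1)
proof (induction rule: evals.induct)
  case (evals_Zero xs)
  show ?case by (auto intro: evals.intros)
next
  case (evals_Succ x)
  have "evals p (Proj 0) (x # ps) ((x # ps) ! 0)" by (rule evals_Proj) simp
  then show ?case by (auto intro!: evals.intros)
next
  case (evals_Proj i xs)
  then show ?case using evals.evals_Proj[of i "xs @ ps" p] by (simp add: nth_append)
next
  case (evals_Oracle x)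
  show ?case using h by simp
next
  case (evals_Comp xs gs ys f z)
  \<comment> \<open>The extra projections added to a composition hand the parameters on to the outer
    program.\<close>
  have "map ((!) (xs @ ps)) [length xs..<length xs + l] = ps"
    using assms(2) by (auto intro!: nth_equalityI simp: nth_append)
  with evals_projs[of "length xs + l" "xs @ ps" p "length xs"] assms(2)
  have "list_all2 (\<lambda>g y. evals p g (xs @ ps) y) (map Proj [length xs..<length xs + l]) ps"
    by simp
  moreover have "list_all2 (\<lambda>g y. evals p g (xs @ ps) y)
      (map (subst_oracle h l (length xs)) gs) ys"
    using evals_Comp.IH(1) by (auto simp: list_all2_conv_all_nth)
  moreover have "length gs = length ys"
    using evals_Comp.IH(1) by (auto dest: list_all2_lengthD)
  ultimately show ?case
    using evals_Comp.IH(2) by (auto intro!: evals.evals_Comp[of _ _ _ "ys @ ps"] list_all2_appendI)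
next
  case (evals_PrimRec_0 f xs z g)
  then show ?case by (auto intro: evals.intros)
next
  case (evals_PrimRec_Suc f g n xs y z)
  then show ?case by (auto intro: evals.intros)
next
  case (evals_Mu f n xs)
  then show ?case by (fastforce intro: evals.evals_Mu)
qed

section \<open>Total functions recursive in an oracle\<close>

text \<open>The set \<open>D\<close> confines the oracles so that unbounded search is available even
  where it terminates only for some of them, such as names of nonempty open sets.\<close>

definition orec :: "baire set \<Rightarrow> nat \<Rightarrow> (baire \<Rightarrow> nat list \<Rightarrow> nat) \<Rightarrow> bool" where
  "orec D k f \<longleftrightarrow> (\<exists>e. \<forall>p\<in>D. \<forall>xs. length xs = k \<longrightarrow> evals p e xs (f p xs))"

lemma orecI:
  assumes "\<And>p xs. p \<in> D \<Longrightarrow> length xs = k \<Longrightarrow> evals p e xs (f p xs)"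
  shows "orec D k f"
  using assms unfolding orec_def by blast

lemma orecE:
  assumes "orec D k f"
  obtains e where "\<And>p xs. p \<in> D \<Longrightarrow> length xs = k \<Longrightarrow> evals p e xs (f p xs)"
  using assms unfolding orec_def by blast

lemma orec_cong:
  assumes "\<And>p xs. p \<in> D \<Longrightarrow> length xs = k \<Longrightarrow> f p xs = g p xs"
  shows "orec D k f \<longleftrightarrow> orec D k g"
  using assms unfolding orec_def by simp

lemma baire_computable_orec:
  assumes "orec D 1 (\<lambda>p xs. f p (xs ! 0))"
  shows "baire_computable (\<lambda>p. if p \<in> D then Some (f p) else None)"
proof -
  from assms obtain e where e: "\<And>p xs. p \<in> D \<Longrightarrow> length xs = 1 \<Longrightarrow> evals p e xs (f p (xs ! 0))"
    by (rule orecE) blast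
  have "evals p e [n] (f p n)" if "p \<in> D" for p n
    using e[OF that, of "[n]"] by simp
  then show ?thesis
    unfolding baire_computable_def by auto
qed

lemma orec_lift:
  assumes f: "orec D (length gs) f" and gs: "\<And>g. g \<in> set gs \<Longrightarrow> orec D k g"
  shows "orec D k (\<lambda>p xs. f p (map (\<lambda>g. g p xs) gs))"
proof -
  from f obtain e where e: "\<And>p xs. p \<in> D \<Longrightarrow> length xs = length gs \<Longrightarrow> evals p e xs (f p xs)"
    by (rule orecE) blast
  from gs obtain E where
    E: "\<And>g p xs. g \<in> set gs \<Longrightarrow> p \<in> D \<Longrightarrow> length xs = k \<Longrightarrow> evals p (E g) xs (g p xs)"
    unfolding orec_def by metis
  show ?thesis
    by (rule orecI[where e = "Comp e (map E gs)"])
       (auto intro!: evals_Comp e E simp: list_all2_conv_all_nth)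
qed

lemma orec_lift1:
  assumes "orec D 1 (\<lambda>p ys. f p (ys ! 0))" "orec D k a"
  shows "orec D k (\<lambda>p xs. f p (a p xs))"
  using orec_lift[of D "[a]" "\<lambda>p ys. f p (ys ! 0)" k] assms by simp

lemma orec_lift2:
  assumes "orec D 2 (\<lambda>p ys. f p (ys ! 0) (ys ! 1))" "orec D k a" "orec D k b"
  shows "orec D k (\<lambda>p xs. f p (a p xs) (b p xs))"
  using orec_lift[of D "[a, b]" "\<lambda>p ys. f p (ys ! 0) (ys ! 1)" k] assms
  by (auto simp: numeral_2_eq_2)

lemma orec_nth: "i < k \<Longrightarrow> orec D k (\<lambda>p xs. xs ! i)"
  by (auto intro: orecI evals_Proj)

text \<open>The bodies of recursions, searches and oracle substitutions see their parameters as a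
  \<open>drop\<close> of the argument list; this reads one of them.\<close>

lemma orec_nth_drop: "j + i < k \<Longrightarrow> orec D k (\<lambda>p xs. drop j xs ! i)"
  using orec_nth[of "j + i" k D] by (subst orec_cong[where g = "\<lambda>p xs. xs ! (j + i)"]) auto

lemma orec_Suc:
  assumes "orec D k a"
  shows "orec D k (\<lambda>p xs. Suc (a p xs))"
proof (rule orec_lift1[OF orecI assms])
  fix p and xs :: "nat list"
  assume "length xs = 1"
  then show "evals p Succ xs (Suc (xs ! 0))"
    by (cases xs) (auto intro: evals_Succ)
qed

lemma orec_oracle:
  assumes "orec D k a"
  shows "orec D k (\<lambda>p xs. p (a p xs))"
proof (rule orec_lift1[OF orecI assms])
  fix p and xs :: "nat list"
  assume "length xs = 1"
  then show "evals p Oracle xs (p (xs ! 0))"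
    by (cases xs) (auto intro: evals_Oracle)
qed

lemma orec_const: "orec D k (\<lambda>p xs. c)"
  by (induction c) (auto intro: orecI evals_Zero orec_Suc)

lemma orec_rec_nat:
  assumes f: "orec D k f"
    and g: "orec D (Suc (Suc k)) (\<lambda>p ys. g p (ys ! 0) (ys ! 1) (drop 2 ys))"
    and a: "orec D k a"
  shows "orec D k (\<lambda>p xs. rec_nat (f p xs) (\<lambda>n y. g p n y xs) (a p xs))"
proof -
  from f obtain ef where ef: "\<And>p xs. p \<in> D \<Longrightarrow> length xs = k \<Longrightarrow> evals p ef xs (f p xs)"
    by (rule orecE) blast
  from g obtain eg where eg: "\<And>p xs. p \<in> D \<Longrightarrow> length xs = Suc (Suc k) \<Longrightarrow>
      evals p eg xs (g p (xs ! 0) (xs ! 1) (drop 2 xs))"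
    by (rule orecE) blast
  from a obtain ea where ea: "\<And>p xs. p \<in> D \<Longrightarrow> length xs = k \<Longrightarrow> evals p ea xs (a p xs)"
    by (rule orecE) blast
  show ?thesis
  proof (rule orecI[where e = "Comp (PrimRec ef eg) (ea # map Proj [0..<k])"])
    fix p and xs :: "nat list"
    assume p: "p \<in> D" and xs: "length xs = k"
    have "evals p (PrimRec ef eg) (n # xs) (rec_nat (f p xs) (\<lambda>n y. g p n y xs) n)" for n
    proof (induction n)
      case 0
      show ?case using ef[OF p xs] by (auto intro: evals_PrimRec_0)
    next
      case (Suc n)
      then show ?case
        using eg[OF p, of "n # _ # xs"] xs by (auto intro: evals_PrimRec_Suc)
    qed
    moreover have "list_all2 (\<lambda>g y. evals p g xs y) (map Proj [0..<k]) xs"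
      using evals_projs[of k xs p 0] xs by (metis map_nth order_refl)
    ultimately show "evals p (Comp (PrimRec ef eg) (ea # map Proj [0..<k])) xs
        (rec_nat (f p xs) (\<lambda>n y. g p n y xs) (a p xs))"
      using ea[OF p xs] by (auto intro!: evals_Comp)
  qed
qed

text \<open>\<open>Mu\<close> needs a positive value at every argument below the result: totality of
  \<open>f\<close> over \<open>D\<close> provides the value, minimality makes it positive.\<close>

lemma orec_Least_eq_0:
  assumes f: "orec D (Suc k) (\<lambda>p ys. f p (ys ! 0) (drop 1 ys))"
    and ex: "\<And>p xs. p \<in> D \<Longrightarrow> length xs = k \<Longrightarrow> \<exists>n. f p n xs = 0"
  shows "orec D k (\<lambda>p xs. LEAST n. f p n xs = 0)"
proof -
  from f obtain e where e: "\<And>p xs. p \<in> D \<Longrightarrow> length xs = Suc k \<Longrightarrow>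
      evals p e xs (f p (xs ! 0) (drop 1 xs))"
    by (rule orecE) blast
  show ?thesis
  proof (rule orecI[where e = "Mu e"])
    fix p and xs :: "nat list"
    assume p: "p \<in> D" and xs: "length xs = k"
    have e': "evals p e (n # xs) (f p n xs)" for n
      using e[OF p, of "n # xs"] xs by simp
    show "evals p (Mu e) xs (LEAST n. f p n xs = 0)"
    proof (rule evals_Mu)
      show "evals p e ((LEAST n. f p n xs = 0) # xs) 0"
        using e' LeastI_ex[OF ex[OF p xs]] by metis
      show "\<forall>m<LEAST n. f p n xs = 0. \<exists>y. evals p e (m # xs) (Suc y)"
        using e' not_less_Least by (metis not0_implies_Suc)
    qed
  qed
qed

text \<open>This runs a fixed realizer \<open>e\<close> on a name that is itself computed from
  \<open>p\<close> and the parameters, as needed to compose realizers.\<close>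

lemma orec_subst_oracle:
  assumes e: "\<And>p ps x. p \<in> D \<Longrightarrow> length ps = l \<Longrightarrow> evals (q p ps) e [x] (r p ps x)"
    and q: "orec D (Suc l) (\<lambda>p xs. q p (drop 1 xs) (xs ! 0))"
  shows "orec D (Suc l) (\<lambda>p xs. r p (drop 1 xs) (xs ! 0))"
proof -
  from q obtain h where h: "\<And>p xs. p \<in> D \<Longrightarrow> length xs = Suc l \<Longrightarrow>
      evals p h xs (q p (drop 1 xs) (xs ! 0))"
    by (rule orecE) blast
  show ?thesis
  proof (rule orecI[where e = "subst_oracle h l 1 e"])
    fix p and xs :: "nat list"
    assume p: "p \<in> D" and xs: "length xs = Suc l"
    then obtain x ps where [simp]: "xs = x # ps" and ps: "length ps = l"
      by (cases xs) auto
    have "evals p h (y # ps) (q p ps y)" for y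
      using h[OF p, of "y # ps"] ps by simp
    from evals_subst_oracle[OF e[OF p ps, of x] ps this]
    show "evals p (subst_oracle h l 1 e) xs (r p (drop 1 xs) (xs ! 0))"
      by simp
  qed
qed

section \<open>Arithmetic, pairing and codes of finite words\<close>

lemma orec_if_0:
  assumes "orec D k a" "orec D k b" "orec D k c"
  shows "orec D k (\<lambda>p xs. if a p xs = 0 then b p xs else c p xs)"
proof -
  have "orec D 3 (\<lambda>p xs. rec_nat (xs ! 1) (\<lambda>n y. xs ! 2) (xs ! 0))"
    by (intro orec_rec_nat orec_nth orec_nth_drop) simp_all
  moreover have "rec_nat v (\<lambda>n y. w) u = (if u = 0 then v else w)" for u v w :: nat
    by (cases u) auto
  ultimately have "orec D (length [a, b, c]) (\<lambda>p xs. if xs ! 0 = 0 then xs ! 1 else xs ! 2)"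
    by (simp add: numeral_3_eq_3 del: One_nat_def)
  from orec_lift[OF this, of k] assms show ?thesis by (auto simp: numeral_2_eq_2 cong: if_cong)
qed

lemma orec_add:
  assumes "orec D k a" "orec D k b"
  shows "orec D k (\<lambda>p xs. a p xs + b p xs)"
proof -
  have "orec D k (\<lambda>p xs. rec_nat (a p xs) (\<lambda>n y. Suc y) (b p xs))"
    by (intro orec_rec_nat orec_Suc orec_nth assms) simp_all
  moreover have "rec_nat u (\<lambda>n y. Suc y) v = u + v" for u v :: nat
    by (induction v) auto
  ultimately show ?thesis by simp
qed

lemma orec_pred:
  assumes "orec D k a"
  shows "orec D k (\<lambda>p xs. a p xs - 1)"
proof -
  have "orec D k (\<lambda>p xs. rec_nat 0 (\<lambda>n y. n) (a p xs))"
    by (intro orec_rec_nat orec_const orec_nth assms) simp_all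
  moreover have "rec_nat 0 (\<lambda>n y. n) v = v - 1" for v :: nat
    by (cases v) auto
  ultimately show ?thesis by simp
qed

lemma orec_diff:
  assumes "orec D k a" "orec D k b"
  shows "orec D k (\<lambda>p xs. a p xs - b p xs)"
proof -
  have "orec D k (\<lambda>p xs. rec_nat (a p xs) (\<lambda>n y. y - 1) (b p xs))"
    by (intro orec_rec_nat orec_pred orec_nth assms) simp_all
  moreover have "rec_nat u (\<lambda>n y. y - 1) v = u - v" for u v :: nat
    by (induction v) auto
  ultimately show ?thesis by simp
qed

lemma orec_triangle:
  assumes "orec D k a"
  shows "orec D k (\<lambda>p xs. triangle (a p xs))"
proof -
  have "orec D k (\<lambda>p xs. rec_nat 0 (\<lambda>n y. y + Suc n) (a p xs))"
    by (intro orec_rec_nat orec_const orec_add orec_Suc orec_nth assms) simp_all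
  moreover have "rec_nat 0 (\<lambda>n y. y + Suc n) v = triangle v" for v
    by (induction v) auto
  ultimately show ?thesis by simp
qed

lemma orec_prod_encode:
  assumes "orec D k a" "orec D k b"
  shows "orec D k (\<lambda>p xs. prod_encode (a p xs, b p xs))"
  unfolding prod_encode_def by (auto intro!: orec_add orec_triangle assms)

lemma triangle_mono: "m \<le> n \<Longrightarrow> triangle m \<le> triangle n"
  unfolding triangle_def by (intro div_le_mono mult_le_mono) auto

text \<open>Since \<open>prod_encode (a, b) = triangle (a + b) + a\<close>, the number
  \<open>d\<close> is the diagonal \<open>a + b\<close>, found as the least one with
  \<open>z < triangle (Suc d)\<close>; the remainder is \<open>a\<close>.\<close>

lemma prod_decode_via_triangle:
  fixes z :: nat
  defines "d \<equiv> LEAST d. Suc z - triangle (Suc d) = 0"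
  shows "prod_decode z = (z - triangle d, d - (z - triangle d))"
proof -
  obtain a b where z: "z = prod_encode (a, b)"
    by (metis prod_decode_inverse surj_pair)
  have "d = a + b"
    unfolding d_def
  proof (rule Least_equality)
    show "Suc z - triangle (Suc (a + b)) = 0"
      by (simp add: z prod_encode_def)
    fix y assume y: "Suc z - triangle (Suc y) = 0"
    show "a + b \<le> y"
    proof (rule ccontr)
      assume "\<not> a + b \<le> y"
      then have "triangle (Suc y) \<le> triangle (a + b)" by (intro triangle_mono) simp
      with y show False by (simp add: z prod_encode_def)
    qed
  qed
  then show ?thesis by (simp add: z) (simp add: prod_encode_def)
qed

lemma orec_prod_decode:
  assumes "orec D k a"
  shows "orec D k (\<lambda>p xs. fst (prod_decode (a p xs)))"
    and "orec D k (\<lambda>p xs. snd (prod_decode (a p xs)))"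
proof -
  have "\<exists>d. Suc z - triangle (Suc d) = 0" for z
    by (rule exI[of _ z]) (simp add: triangle_def)
  then have *: "orec D 1 (\<lambda>p xs. LEAST d. Suc (xs ! 0) - triangle (Suc d) = 0)"
    by (intro orec_Least_eq_0 orec_diff orec_triangle orec_Suc orec_nth orec_nth_drop) simp_all
  show "orec D k (\<lambda>p xs. fst (prod_decode (a p xs)))"
    by (rule orec_lift1[OF _ assms])
      (simp only: prod_decode_via_triangle fst_conv,
       intro orec_diff orec_triangle orec_nth *, simp)
  show "orec D k (\<lambda>p xs. snd (prod_decode (a p xs)))"
    by (rule orec_lift1[OF _ assms])
      (simp only: prod_decode_via_triangle snd_conv,
       intro orec_diff orec_triangle orec_nth *, simp_all)
qed

lemma list_encode_map_upt:
  "list_encode (map q [0..<k]) =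
    rec_nat 0 (\<lambda>i y. Suc (prod_encode (q (k - Suc i), y))) k"
proof -
  \<comment> \<open>The word is built from its end: after \<open>i\<close> rounds the code is that
    of the last \<open>i\<close> digits.\<close>
  have "i \<le> k \<Longrightarrow> rec_nat 0 (\<lambda>i y. Suc (prod_encode (q (k - Suc i), y))) i =
      list_encode (map q [k - i..<k])" for i
  proof (induction i)
    case (Suc i)
    then have "[k - Suc i..<k] = (k - Suc i) # [k - i..<k]"
      by (simp add: upt_conv_Cons Suc_diff_Suc)
    with Suc show ?case by simp
  qed simp
  from this[of k] show ?thesis by simp
qed

section \<open>From open choice to a dense sequence\<close>

text \<open>The word with code \<open>z\<close>, continued by the associate's encoding \<open>2\<close> of the digit \<open>1\<close>.\<close>

definition word_fill :: "nat \<Rightarrow> baire" where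
  "word_fill z c =
    (let t = rec_nat z (\<lambda>_ y. snd (prod_decode (y - 1))) c
     in if t = 0 then 2 else fst (prod_decode (t - 1)))"

lemma word_fill_list_encode:
  "word_fill (list_encode w) c = (if c < length w then w ! c else 2)"
proof -
  have "rec_nat (list_encode w) (\<lambda>_ y. snd (prod_decode (y - 1))) c = list_encode (drop c w)"
  proof (induction c)
    case (Suc c)
    show ?case
    proof (cases "drop c w")
      case Nil
      \<comment> \<open>The code 0 of the empty word reproduces itself, because
        \<open>0 - 1 = 0\<close> and \<open>prod_decode 0 = (0, 0)\<close>.\<close>
      then show ?thesis using Suc by (simp add: prod_decode_def prod_decode_aux.simps)
    next
      case (Cons x xs)
      then have "drop (Suc c) w = xs" by (metis drop_Suc list.sel(3) tl_drop)
      with Cons Suc show ?thesis by simp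
    qed
  qed simp
  moreover have "drop c w = w ! c # drop (Suc c) w" if "c < length w"
    using that by (simp add: Cons_nth_drop_Suc)
  ultimately show ?thesis by (auto simp: word_fill_def Let_def)
qed

lemma orec_word_fill:
  assumes "orec D k a" "orec D k b"
  shows "orec D k (\<lambda>p xs. word_fill (a p xs) (b p xs))"
  unfolding word_fill_def Let_def
  by (intro orec_if_0 orec_rec_nat orec_const orec_prod_decode orec_pred orec_nth assms) simp_all

lemma length_le_list_encode: "length xs \<le> list_encode xs"
  by (induction xs) (auto intro: order_trans[OF _ le_prod_encode_2])

lemma open_name_word_fill: "open_name \<rho> (word_fill z) (ran \<rho>)"
proof -
  define w where "w = list_decode z"
  have fill: "word_fill z c = (if c < length w then w ! c else 2)" for c
    using word_fill_list_encode[of w c] by (simp add: w_def)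
  have "\<exists>r. assoc_app (word_fill z) q = Some r \<and> r \<noteq> (\<lambda>_. 0)" for q
  proof -
    let ?ask = "\<lambda>n k. word_fill z (list_encode (n # map q [0..<k]))"
    \<comment> \<open>A query carrying \<open>length w\<close> digits of \<open>q\<close> has a code
      beyond the end of \<open>w\<close>, so it is answered by the filler 2. Hence every digit is
      eventually decided.\<close>
    have "?ask n (length w) > 0" for n
      using length_le_list_encode[of "n # map q [0..<length w]"] by (simp add: fill)
    then have *: "\<forall>n. \<exists>k. ?ask n k > 0" by blast
    \<comment> \<open>For digit number \<open>length w\<close>, all queries, even the shortest, have
      codes beyond \<open>w\<close>; this digit is 1 whatever \<open>q\<close> is.\<close>
    have "\<not> list_encode (length w # map q [0..<k]) < length w" for k
      using le_prod_encode_1[of "length w" "list_encode (map q [0..<k])"]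
      by (simp del: le_prod_encode_1)
    then have "?ask (length w) k = 2" for k
      by (simp only: fill if_False)
    then have "?ask (length w) (LEAST k. ?ask (length w) k > 0) - 1 = 1"
      by (simp only:)
    then have "(\<lambda>n. ?ask n (LEAST k. ?ask n k > 0) - 1) \<noteq> (\<lambda>_. 0)"
      by (metis zero_neq_one)
    with * show ?thesis
      unfolding assoc_app_def Let_def by (simp del: list_encode.simps)
  qed
  moreover have "openin (final_topology \<rho>) (ran \<rho>)"
    using openin_topspace[of "final_topology \<rho>"] by (simp add: topspace_final_topology)
  ultimately show ?thesis
    unfolding open_name_def names_map_def realizes_def sierpinski_rep_def by (auto simp: ran_def)
qed

section \<open>Prefixes and names of arbitrary open sets\<close>

lemma open_contains_cylinder:
  fixes W :: "baire set"
  assumes "open W" "q \<in> W"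
  obtains k where "\<And>r. (\<And>i. i < k \<Longrightarrow> r i = q i) \<Longrightarrow> r \<in> W"
proof -
  have "openin (product_topology (\<lambda>_. euclidean) UNIV) W"
    using assms(1) by (simp add: open_fun_def)
  from product_topology_open_contains_basis[OF this assms(2)]
  obtain V where V: "q \<in> Pi\<^sub>E UNIV V" "Pi\<^sub>E UNIV V \<subseteq> W" and "finite {i. V i \<noteq> topspace euclidean}"
    by blast
  then obtain k where "\<forall>i\<in>{i. V i \<noteq> topspace euclidean}. i < k"
    unfolding finite_nat_set_iff_bounded by blast
  then have k: "V i \<noteq> UNIV \<Longrightarrow> i < k" for i
    by simp
  have "r \<in> W" if "\<And>i. i < k \<Longrightarrow> r i = q i" for r
  proof -
    have "r i \<in> V i" for i
      using k[of i] that[of i] V(1) by (cases "V i = UNIV") (auto simp: PiE_iff)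
    with V(2) show ?thesis by (auto simp: PiE_iff)
  qed
  then show ?thesis by (rule that)
qed

text \<open>The associate need not be computable, so it may consult an open set \<open>W\<close> of
  sequences that cuts out the names of points of \<open>U\<close>.\<close>

lemma open_name_exists:
  assumes U: "openin (final_topology \<rho>) U"
  shows "\<exists>p. open_name \<rho> p U"
proof -
  from U obtain W where W: "open W" "{p \<in> dom \<rho>. the (\<rho> p) \<in> U} = dom \<rho> \<inter> W"
    by (auto simp: openin_final_topology openin_open)
  define cyl :: "nat list \<Rightarrow> baire set" where "cyl w = {r. map r [0..<length w] = w}" for w
  text \<open>Digit \<open>n\<close> of the answer is \<open>1\<close> if a prefix of length at most \<open>n\<close> already ensures
    membership in \<open>W\<close>, and \<open>0\<close> otherwise.\<close>
  define p where "p c = (let w = tl (list_decode c); n = hd (list_decode c)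
    in if cyl w \<subseteq> W then 2 else if n \<le> length w then 1 else (0::nat))" for c
  have cyl: "cyl (map q [0..<k]) = {r. \<forall>i<k. r i = q i}" for q k
    by (auto simp: cyl_def)
  have ask: "p (list_encode (n # map q [0..<k])) =
      (if {r. \<forall>i<k. r i = q i} \<subseteq> W then 2 else if n \<le> k then 1 else 0)" for n q k
    unfolding p_def list_encode_inverse Let_def list.sel cyl by simp
  have app: "\<exists>r. assoc_app p q = Some r \<and> (r \<noteq> (\<lambda>_. 0) \<longleftrightarrow> q \<in> W)" for q
  proof -
    define A where
      "A n k = (if {r. \<forall>i<k. r i = q i} \<subseteq> W then 2 else if n \<le> k then 1 else (0::nat))" for n k
    define r where "r n = A n (LEAST k. A n k > 0) - 1" for n
    have tot: "\<exists>k. A n k > 0" for n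
      by (rule exI[of _ n]) (simp add: A_def)
    then have "assoc_app p q = Some r"
      unfolding assoc_app_def ask A_def[symmetric] Let_def r_def by simp
    moreover have "r \<noteq> (\<lambda>_. 0)" if qW: "q \<in> W"
    proof -
      obtain k where "\<And>r. (\<And>i. i < k \<Longrightarrow> r i = q i) \<Longrightarrow> r \<in> W"
        by (rule open_contains_cylinder[OF W(1) qW]) blast
      then have k: "{r. \<forall>i<k. r i = q i} \<subseteq> W" by blast
      \<comment> \<open>For digit \<open>Suc k\<close> the answer 1 is impossible on prefixes of
        length at most \<open>k\<close>, so the first positive answer, at \<open>l \<le> k\<close>,
        is 2.\<close>
      define l where "l = (LEAST j. A (Suc k) j > 0)"
      have "A (Suc k) l > 0"
        unfolding l_def by (rule LeastI_ex[OF tot])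
      moreover have "l \<le> k"
        unfolding l_def by (rule Least_le) (use k in \<open>simp add: A_def\<close>)
      ultimately have "A (Suc k) l = 2" by (simp add: A_def split: if_splits)
      then have "r (Suc k) = 1" by (simp add: r_def l_def)
      then show ?thesis by auto
    qed
    moreover have "r = (\<lambda>_. 0)" if "q \<notin> W"
    proof -
      \<comment> \<open>Every cylinder around \<open>q\<close> contains \<open>q\<close> itself, so
        none lies inside \<open>W\<close> and the answer 2 never occurs.\<close>
      have "A n k \<le> 1" for n k using that by (auto simp: A_def)
      then show ?thesis by (simp add: r_def fun_eq_iff)
    qed
    ultimately show ?thesis by blast
  qed
  have "names_map \<rho> sierpinski_rep p (\<lambda>x. x \<in> U)"
    unfolding names_map_def realizes_def sierpinski_rep_def
  proof (intro allI impI)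
    fix q x assume "\<rho> q = Some x \<and> {x \<in> U} \<noteq> {}"
    then have "q \<in> dom \<rho>" "the (\<rho> q) = x" by auto
    with W(2) have "x \<in> U \<longleftrightarrow> q \<in> W" by blast
    with app[of q] show "\<exists>r y. assoc_app p q = Some r \<and> Some (r \<noteq> (\<lambda>_. 0)) = Some y \<and> y \<in> {x \<in> U}"
      by simp
  qed
  with U show ?thesis unfolding open_name_def by blast
qed

lemma computably_separable_if_open_choice:
  assumes ne: "ran \<rho> \<noteq> {}" and oc: "computable_open_choice \<rho>"
  shows "computably_separable \<rho>"
proof -
  from oc obtain F e where
    F: "\<And>p U. open_name \<rho> p U \<Longrightarrow> U \<noteq> {} \<Longrightarrow> \<exists>q y. F p = Some q \<and> \<rho> q = Some y \<and> y \<in> U"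
    and e: "\<And>p q n. F p = Some q \<Longrightarrow> evals p e [n] (q n)"
    unfolding computable_open_choice_def computable_multi_def realizes_def baire_computable_def
      open_choice_def open_rep_eq_Some_iff
    by metis
  have "\<exists>q y. F (word_fill z) = Some q \<and> \<rho> q = Some y" for z
    using F[OF open_name_word_fill[of \<rho> z] ne] by blast
  \<comment> \<open>\<open>Q z\<close> is the realizer's output on the name of the whole space that
    begins with the word coded by \<open>z\<close>; nonemptiness of the space makes this choice
    legitimate.\<close>
  then obtain Q s where Q: "\<And>z. F (word_fill z) = Some (Q z)" "\<And>z. \<rho> (Q z) = Some (s z)"
    by metis
  \<comment> \<open>Here \<open>p\<close> names the index \<open>p 0\<close>, and \<open>e\<close>
    is run with \<open>word_fill (p 0)\<close> as its oracle.\<close>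
  have "orec UNIV (Suc 0) (\<lambda>p xs. Q (p 0) (xs ! 0))"
  proof (rule orec_subst_oracle)
    show "evals (word_fill (p 0)) e [x] (Q (p 0) x)" for p x
      by (rule e[OF Q(1)])
    show "orec UNIV (Suc 0) (\<lambda>p xs. word_fill (p 0) (xs ! 0))"
      by (intro orec_word_fill orec_oracle orec_const orec_nth) simp
  qed
  then have "baire_computable (\<lambda>p. Some (Q (p 0)))"
    using baire_computable_orec[of UNIV "\<lambda>p. Q (p 0)"] by simp
  then have s: "computable_map nat_rep \<rho> s"
    using Q(2) unfolding computable_map_def computable_multi_def realizes_def nat_rep_def
    by auto
  have "\<exists>z. s z \<in> U" if U: "openin (final_topology \<rho>) U" "U \<noteq> {}" for U
  proof -
    from open_name_exists[OF U(1)] obtain p where p: "open_name \<rho> p U" ..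
    from F[OF p U(2)] obtain q y where q: "F p = Some q" "\<rho> q = Some y" "y \<in> U" by blast
    from U(1) obtain W where W: "open W" "{p \<in> dom \<rho>. the (\<rho> p) \<in> U} = dom \<rho> \<inter> W"
      by (auto simp: openin_final_topology openin_open)
    have "q \<in> W" using W(2) q by (metis (mono_tags, lifting) IntD2 domI mem_Collect_eq option.sel)
    then obtain k where k: "\<And>r. (\<And>i. i < k \<Longrightarrow> r i = q i) \<Longrightarrow> r \<in> W"
      using open_contains_cylinder[OF W(1)] by blast
    \<comment> \<open>Membership in \<open>W\<close> depends on the first \<open>k\<close> digits of
      \<open>q\<close>, and these depend on finitely many digits of \<open>p\<close>.\<close>
    have "\<forall>\<^sub>F j in sequentially. \<forall>n\<in>{..<k}.
        \<forall>p'. (\<forall>i<j. p' i = p i) \<longrightarrow> evals p' e [n] (q n)"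
      by (rule eventually_ball_finite) (auto intro!: evals_continuous e q)
    then obtain j where
      j: "\<And>n p'. n < k \<Longrightarrow> (\<And>i. i < j \<Longrightarrow> p' i = p i) \<Longrightarrow> evals p' e [n] (q n)"
      unfolding eventually_sequentially by (metis lessThan_iff order_refl)
    define z where "z = list_encode (map p [0..<j])"
    \<comment> \<open>On the oracle \<open>word_fill z\<close>, which agrees with \<open>p\<close>
      below \<open>j\<close>, the program \<open>e\<close> yields both \<open>Q z n\<close> and, by
      continuity, \<open>q n\<close>.\<close>
    have "Q z n = q n" if "n < k" for n
    proof (rule evals_deterministic)
      show "evals (word_fill z) e [n] (Q z n)" by (rule e[OF Q(1)])
      show "evals (word_fill z) e [n] (q n)"
        by (rule j[OF that]) (simp add: z_def word_fill_list_encode)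
    qed
    then have "Q z \<in> W" by (rule k)
    then have "s z \<in> U"
      using W(2) Q(2)[of z] by (metis (mono_tags, lifting) IntI domI mem_Collect_eq option.sel)
    then show ?thesis ..
  qed
  then have "final_topology \<rho> closure_of range s = topspace (final_topology \<rho>)"
    by (fastforce simp: in_closure_of)
  with s show ?thesis unfolding computably_separable_def by blast
qed

section \<open>Searching a dense sequence\<close>

text \<open>Common basis for open choice and overtness: \<open>q n\<close> is a name of
  \<open>s n\<close>, and \<open>r p n\<close> is the answer of the associate \<open>p\<close> to
  it. The latter is computable only for \<open>p\<close> naming an open set, since elsewhere the
  associate may stay undecided.\<close>

lemma separable_membership_test:
  assumes "computably_separable \<rho>"
  obtains q s r where
    "\<And>D. orec D 2 (\<lambda>p xs. q (xs ! 0) (xs ! 1))"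
    "\<And>n. \<rho> (q n) = Some (s n)"
    "orec (dom (open_rep \<rho>)) 2 (\<lambda>p xs. r p (xs ! 0) (xs ! 1))"
    "\<And>p U n. open_name \<rho> p U \<Longrightarrow> s n \<in> U \<longleftrightarrow> (\<exists>m. r p n m > 0)"
    "\<And>p U. open_name \<rho> p U \<Longrightarrow> U \<noteq> {} \<longleftrightarrow> (\<exists>n. s n \<in> U)"
proof -
  from assms obtain s where "computable_map nat_rep \<rho> s"
    and dense: "final_topology \<rho> closure_of range s = topspace (final_topology \<rho>)"
    unfolding computably_separable_def by blast
  then obtain F e where
    F: "\<And>p. \<exists>q. F p = Some q \<and> \<rho> q = Some (s (p 0))"
    and e: "\<And>p q n. F p = Some q \<Longrightarrow> evals p e [n] (q n)"
    unfolding computable_map_def computable_multi_def realizes_def baire_computable_def nat_rep_def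
    by simp blast
  \<comment> \<open>Fixing the constant sequence as the name of \<open>n\<close> makes the name
    \<open>q n\<close> of \<open>s n\<close> depend on \<open>n\<close> alone.\<close>
  from F[of "\<lambda>_. _"] obtain q where q: "\<And>n. F (\<lambda>_. n) = Some (q n)" "\<And>n. \<rho> (q n) = Some (s n)"
    by metis
  have "orec D (Suc 1) (\<lambda>p xs. q (drop 1 xs ! 0) (xs ! 0))" for D
  proof (rule orec_subst_oracle)
    show "evals (\<lambda>_. ps ! 0) e [x] (q (ps ! 0) x)" for ps x
      by (rule e[OF q(1)])
    show "orec D (Suc 1) (\<lambda>p xs. drop 1 xs ! 0)"
      by (rule orec_nth_drop) simp
  qed
  then have q': "orec D 2 (\<lambda>p xs. q (xs ! 1) (xs ! 0))" for D
    by (subst orec_cong[where g = "\<lambda>p xs. q (drop 1 xs ! 0) (xs ! 0)"]) (auto simp: numeral_2_eq_2)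
  have q_rec: "orec D k (\<lambda>p xs. q (a p xs) (b p xs))" if "orec D k a" "orec D k b" for D k a b
    by (rule orec_lift2[where f = "\<lambda>p x y. q y x", OF q' that(2,1)])
  define ask where "ask p n m k = p (list_encode (m # map (q n) [0..<k]))" for p :: baire and n m k
  \<comment> \<open>The condition \<open>1 - v = 0\<close> expresses \<open>v > 0\<close> as a
    search for a zero, the form that \<open>Mu\<close> handles.\<close>
  define r where "r p n m = ask p n m (LEAST k. 1 - ask p n m k = 0) - 1" for p n m
  have name: "(\<forall>m. \<exists>k. ask p n m k > 0) \<and> (s n \<in> U \<longleftrightarrow> (\<exists>m. r p n m > 0))"
    if "open_name \<rho> p U" for p U n
  proof -
    have "realizes \<rho> sierpinski_rep (assoc_app p) (\<lambda>x. {x \<in> U})"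
      using that by (simp add: open_name_def names_map_def)
    then obtain t where t: "assoc_app p (q n) = Some t" "(t \<noteq> (\<lambda>_. 0)) = (s n \<in> U)"
      unfolding realizes_def sierpinski_rep_def using q(2)[of n] by blast
    have pos: "1 - v = 0 \<longleftrightarrow> v > 0" for v :: nat by auto
    have "\<forall>m. \<exists>k. ask p n m k > 0"
      by (rule ccontr) (use t(1) in \<open>simp only: assoc_app_def Let_def ask_def if_False option.distinct\<close>)
    moreover from this have "t = r p n"
      using t(1) unfolding assoc_app_def Let_def ask_def[symmetric] r_def pos by simp
    ultimately show ?thesis
      using t(2) by (auto simp: fun_eq_iff)
  qed
  have ask_rec: "orec D 3 (\<lambda>p xs. ask p (xs ! 1) (xs ! 2) (xs ! 0))" for D
    unfolding ask_def list_encode.simps list_encode_map_upt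
    by (intro orec_oracle orec_Suc orec_prod_encode orec_rec_nat q_rec orec_diff orec_const
        orec_nth orec_nth_drop) simp_all
  have ask_lift: "orec D k (\<lambda>p xs. ask p (a p xs) (b p xs) (c p xs))"
    if "orec D k a" "orec D k b" "orec D k c" for D k a b c
    using orec_lift[of D "[c, a, b]" "\<lambda>p xs. ask p (xs ! 1) (xs ! 2) (xs ! 0)" k] ask_rec that
    by (auto simp: numeral_3_eq_3)
  have r_rec: "orec (dom (open_rep \<rho>)) 2 (\<lambda>p xs. r p (xs ! 0) (xs ! 1))"
    unfolding r_def
  proof (intro orec_pred ask_lift orec_Least_eq_0 orec_diff orec_const orec_nth orec_nth_drop)
    fix p and xs :: "nat list"
    assume "p \<in> dom (open_rep \<rho>)"
    then obtain U where "open_name \<rho> p U" by (auto simp: open_rep_eq_Some_iff)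
    with name obtain k where "ask p (xs ! 0) (xs ! 1) k > 0" by blast
    then show "\<exists>k. 1 - ask p (xs ! 0) (xs ! 1) k = 0"
      by (intro exI[of _ k]) simp
  qed simp_all
  have meets: "U \<noteq> {} \<longleftrightarrow> (\<exists>n. s n \<in> U)" if "open_name \<rho> p U" for p U
  proof -
    have "openin (final_topology \<rho>) U" using that by (simp add: open_name_def)
    moreover from this have "U \<subseteq> final_topology \<rho> closure_of range s"
      unfolding dense by (rule openin_subset)
    ultimately show ?thesis
      unfolding in_closure_of subset_iff by blast
  qed
  show ?thesis
  proof (rule that)
    show "orec D 2 (\<lambda>p xs. q (xs ! 0) (xs ! 1))" for D
      by (intro q_rec orec_nth) simp_all
    show "s n \<in> U \<longleftrightarrow> (\<exists>m. r p n m > 0)" if "open_name \<rho> p U" for p U n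
      using name[OF that] by blast
  qed (use q(2) r_rec meets in auto)
qed

lemma open_choice_if_computably_separable:
  assumes "computably_separable \<rho>"
  shows "computable_open_choice \<rho>"
proof -
  from assms obtain q s r where
    q: "\<And>D. orec D 2 (\<lambda>p xs. q (xs ! 0) (xs ! 1))"
      "\<And>n. \<rho> (q n) = Some (s n)"
    and r: "orec (dom (open_rep \<rho>)) 2 (\<lambda>p xs. r p (xs ! 0) (xs ! 1))"
    and mem: "\<And>p U n. open_name \<rho> p U \<Longrightarrow> s n \<in> U \<longleftrightarrow> (\<exists>m. r p n m > 0)"
    and meets: "\<And>p U. open_name \<rho> p U \<Longrightarrow> U \<noteq> {} \<longleftrightarrow> (\<exists>n. s n \<in> U)"
    by (rule separable_membership_test) blast
  define D where "D = {p. \<exists>U. open_name \<rho> p U \<and> U \<noteq> {}}"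
  define hit where "hit p t = r p (fst (prod_decode t)) (snd (prod_decode t))" for p t
  \<comment> \<open>\<open>sel p\<close> is the index in the first pair \<open>(n, m)\<close> found
    with a positive digit; the search terminates for \<open>p\<close> in \<open>D\<close>.\<close>
  define sel where "sel p = fst (prod_decode (LEAST t. 1 - hit p t = 0))" for p
  have sub: "D \<subseteq> dom (open_rep \<rho>)"
    by (auto simp: D_def open_rep_eq_Some_iff)
  have ex: "\<exists>t. 1 - hit p t = 0" if "p \<in> D" for p
  proof -
    from that obtain U where U: "open_name \<rho> p U" "U \<noteq> {}" unfolding D_def by blast
    with meets obtain n where "s n \<in> U" by blast
    with mem[OF U(1)] obtain m where "r p n m > 0" by blast
    then show ?thesis by (intro exI[of _ "prod_encode (n, m)"]) (simp add: hit_def)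
  qed
  have "orec (dom (open_rep \<rho>)) 2 (\<lambda>p xs. 1 - hit p (xs ! 0))"
    unfolding hit_def by (intro orec_diff orec_const orec_lift2[OF r] orec_prod_decode orec_nth) simp_all
  with sub have "orec D (Suc 1) (\<lambda>p xs. 1 - hit p (xs ! 0))"
    unfolding orec_def numeral_2_eq_2 One_nat_def by blast
  then have "orec D 1 (\<lambda>p xs. q (sel p) (xs ! 0))"
    unfolding sel_def
    by (intro orec_lift2[where f = "\<lambda>_. q", OF q(1)] orec_prod_decode orec_Least_eq_0 orec_nth ex)
      simp_all
  then have "baire_computable (\<lambda>p. if p \<in> D then Some (q (sel p)) else None)"
    by (rule baire_computable_orec)
  moreover have "s (sel p) \<in> U" if "open_name \<rho> p U" "U \<noteq> {}" for p U
  proof -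
    have "p \<in> D" using that by (auto simp: D_def)
    from LeastI_ex[OF ex[OF this]] have "hit p (LEAST t. 1 - hit p t = 0) > 0" by linarith
    then have "\<exists>m. r p (sel p) m > 0" unfolding hit_def[of p "Least _"] sel_def by blast
    with mem[OF that(1)] show ?thesis by blast
  qed
  then have "realizes (open_rep \<rho>) \<rho> (\<lambda>p. if p \<in> D then Some (q (sel p)) else None) open_choice"
    unfolding realizes_def open_choice_def open_rep_eq_Some_iff using q(2) by (auto simp: D_def)
  ultimately show ?thesis
    unfolding computable_open_choice_def computable_multi_def by blast
qed

text \<open>No search is required: listing the digits \<open>r p n m\<close> along all pairs already
  gives a Sierpinski name of the answer, nonzero iff some \<open>s n\<close> lies in
  \<open>U\<close>.\<close>

lemma overt_if_computably_separable:
  assumes "computably_separable \<rho>"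
  shows "overt \<rho>"
proof -
  from assms obtain q s r where
    "\<And>D. orec D 2 (\<lambda>p xs. q (xs ! 0) (xs ! 1))"
    "\<And>n. \<rho> (q n) = Some (s n)"
    and r: "orec (dom (open_rep \<rho>)) 2 (\<lambda>p xs. r p (xs ! 0) (xs ! 1))"
    and mem: "\<And>p U n. open_name \<rho> p U \<Longrightarrow> s n \<in> U \<longleftrightarrow> (\<exists>m. r p n m > 0)"
    and meets: "\<And>p U. open_name \<rho> p U \<Longrightarrow> U \<noteq> {} \<longleftrightarrow> (\<exists>n. s n \<in> U)"
    by (rule separable_membership_test) blast
  define hit where "hit p t = r p (fst (prod_decode t)) (snd (prod_decode t))" for p t
  have "orec (dom (open_rep \<rho>)) 1 (\<lambda>p xs. hit p (xs ! 0))"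
    unfolding hit_def by (intro orec_lift2[OF r] orec_prod_decode orec_nth) simp_all
  from baire_computable_orec[OF this]
  have "baire_computable (\<lambda>p. if p \<in> dom (open_rep \<rho>) then Some (hit p) else None)" .
  moreover have "hit p \<noteq> (\<lambda>_. 0) \<longleftrightarrow> U \<noteq> {}" if "open_name \<rho> p U" for p U
  proof -
    have "hit p \<noteq> (\<lambda>_. 0) \<longleftrightarrow> (\<exists>n m. r p n m > 0)"
      unfolding hit_def fun_eq_iff by (metis fst_conv gr0I less_irrefl prod_encode_inverse snd_conv)
    with mem[OF that] meets[OF that] show ?thesis by blast
  qed
  then have "realizes (open_rep \<rho>) sierpinski_rep
      (\<lambda>p. if p \<in> dom (open_rep \<rho>) then Some (hit p) else None) (\<lambda>U. {U \<noteq> {}})"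
    unfolding realizes_def sierpinski_rep_def by (auto simp: open_rep_eq_Some_iff)
  ultimately show ?thesis
    unfolding overt_def computable_map_def computable_multi_def by blast
qed

text \<open>An empty space has no sequence of points, so overtness cannot come from separability
  there; its only open set is empty and the zero sequence is the right answer.\<close>

lemma overt_empty:
  assumes "ran \<rho> = {}"
  shows "overt \<rho>"
proof -
  have "baire_computable (\<lambda>_. Some (\<lambda>_. 0))"
    unfolding baire_computable_def by (auto intro: evals_Zero)
  moreover have "U = {}" if "open_name \<rho> p U" for p U
    using that assms by (auto simp: open_name_def openin_final_topology)
  then have "realizes (open_rep \<rho>) sierpinski_rep (\<lambda>_. Some (\<lambda>_. 0)) (\<lambda>U. {U \<noteq> {}})"
    unfolding realizes_def sierpinski_rep_def by (auto simp: open_rep_eq_Some_iff)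
  ultimately show ?thesis
    unfolding overt_def computable_map_def computable_multi_def by blast
qed

theorem theorem9p3:
  fixes X :: "'x set" and \<rho> :: "baire \<rightharpoonup> 'x"
  assumes "represented_space X \<rho>"
  shows "(X \<noteq> {} \<longrightarrow> (computable_open_choice \<rho> \<longleftrightarrow> computably_separable \<rho>)) \<and>
         (computable_open_choice \<rho> \<longrightarrow> overt \<rho>)"
proof -
  have "ran \<rho> = X" using assms by (simp add: represented_space_def)
  then show ?thesis
    using computably_separable_if_open_choice open_choice_if_computably_separable
      overt_if_computably_separable overt_empty by metis
qed

end
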